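(* Let $E$ and $F$ be elementary strong shift equivalent row-finite graphs, with vertex matrices $B_E=RS$ and $B_F=SR$, and let $X$ be the associated imprimitivity graph. Then the groupoid of $X$ pointed at $E^0$ is isomorphic to $\mathcal{G}_E$, and the groupoid of $X$ pointed at $F^0$ is isomorphic to $\mathcal{G}_F$ (as topological groupoids): $\mathcal{G}_{(X,E^0)}\cong\mathcal{G}_E$ and $\mathcal{G}_{(X,F^0)}\cong\mathcal{G}_F$.
   Context: Graphs. A directed graph $E$ consists of a vertex set $E^0$, an edge set $E^1$ and source and range maps $s,r:E^1\to E^0$. Throughout, "graph" means a countable directed graph without multiple edges (at most one edge from $v$ to $w$ for each ordered pair $(v,w)$; loops allowed) which is connected (any two vertices are joined by an undirected path). $E$ is row-finite if every vertex is the source of only finitely many edges. The vertex matrix $B_E$ is the $E^0\times E^0$ matrix with $B_E(v,w)=\#\{e\in E^1: s(e)=v,\ r(e)=w\}$. Elementary strong shift equivalence. A matrix $A$ is elementary strong shift equivalent to a matrix $B$ if there are matrices $R,S$ with nonnegative integer entries such that $A=RS$ and $B=SR$. Graphs $E,F$ are elementary strong shift equivalent if their vertex matrices are; then $R$ is indexed by $E^0\times F^0$ and $S$ by $F^0\times E^0$. The imprimitivity graph $X$ is the bipartite directed graph whose vertex set is the disjoint union $E^0\sqcup F^0$ and whose vertex matrix is $B_X=\begin{pmatrix}0&R\\S&0\end{pmatrix}$. Path groupoid. $E^*$ denotes the set of finite paths (including vertices as paths of length $0$), $E^\infty$ the set of infinite paths $x=x_1x_2\cdots$; $|\alpha|$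 is the length of $\alpha\in E^*$. For $x,y\in E^\infty$, $k\in\mathbf{Z}$, write $x\sim_k y$ if $x_i=y_{i-k}$ for all large $i$. Then $\mathcal{G}_E=\{(x,k,y):x\sim_k y\}$ with $(x,k,y)^{-1}=(y,-k,x)$ and $(x,k,y)(y,l,z)=(x,k+l,z)$, with the topology generated by the sets $Z(\alpha,\beta)=\{(\alpha x,|\alpha|-|\beta|,\beta x): x\in E^\infty,\ s(x)=r(\alpha)\}$ for $\alpha,\beta\in E^*$ with $r(\alpha)=r(\beta)$. For a set $S_0$ of vertices of a graph $X$, the groupoid of $X$ pointed at $S_0$ is $\mathcal{G}_{(X,S_0)}=\{(x,k,y)\in\mathcal{G}_X: s(x),s(y)\in S_0\}$, the restriction of $\mathcal{G}_X$ to $\{x\in X^\infty:s(x)\in S_0\}$. *)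

theory Defs
  imports
    "HOL-Analysis.Analysis"
    "HOL-Library.Stream"
    "Graph_Theory.Digraph_Component"
    "Graph_Theory.Arc_Walk"
begin

section \<open>Graphs\<close>

text \<open>
  The library constant \<^const>\<open>Digraph_Component.connected\<close> excludes the null graph, which
  satisfies the condition ``any two vertices are joined by an undirected path'' vacuously.
\<close>
definition graph_convention :: "('v, 'e) pre_digraph \<Rightarrow> bool" where
  "graph_convention G \<longleftrightarrow>
     nomulti_digraph G \<and> countable (verts G) \<and> countable (arcs G) \<and>
     (verts G = {} \<or> Digraph_Component.connected G)"

definition row_finite :: "('v, 'e) pre_digraph \<Rightarrow> bool" where
  "row_finite G \<longleftrightarrow> (\<forall>v\<in>verts G. finite (out_arcs G v))"

definition arcs_from_to :: "('v, 'e) pre_digraph \<Rightarrow> 'v \<Rightarrow> 'v \<Rightarrow> 'e set" where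
  "arcs_from_to G v w = {e \<in> arcs G. tail G e = v \<and> head G e = w}"

text \<open>
  The cardinality is junk (zero) for an infinite set of parallel arcs.  This cannot happen for a
  graph without multiple edges, and it is excluded explicitly in \<open>imprimitivity_graph\<close> below.
\<close>
definition vertex_matrix :: "('v, 'e) pre_digraph \<Rightarrow> 'v \<Rightarrow> 'v \<Rightarrow> nat" where
  "vertex_matrix G v w = card (arcs_from_to G v w)"


section \<open>Elementary strong shift equivalence\<close>

text \<open>
  \<open>A = R S\<close>, where \<open>R\<close> is an \<open>I \<times> K\<close> matrix and \<open>S\<close> a \<open>K \<times> J\<close> matrix.  The inner index set may be
  infinite; as \<^typ>\<open>nat\<close> carries the discrete topology, \<^const>\<open>has_sum\<close> means that only finitely
  many summands are nonzero and that their sum is the given entry.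
\<close>
definition is_matrix_product ::
  "'i set \<Rightarrow> 'k set \<Rightarrow> 'j set \<Rightarrow> ('i \<Rightarrow> 'j \<Rightarrow> nat) \<Rightarrow> ('i \<Rightarrow> 'k \<Rightarrow> nat) \<Rightarrow> ('k \<Rightarrow> 'j \<Rightarrow> nat) \<Rightarrow> bool" where
  "is_matrix_product I K J A R S \<longleftrightarrow>
     (\<forall>i\<in>I. \<forall>j\<in>J. ((\<lambda>k. R i k * S k j) has_sum A i j) K)"

definition elementary_sse_via ::
  "('v, 'e) pre_digraph \<Rightarrow> ('w, 'f) pre_digraph \<Rightarrow> ('v \<Rightarrow> 'w \<Rightarrow> nat) \<Rightarrow> ('w \<Rightarrow> 'v \<Rightarrow> nat) \<Rightarrow> bool" where
  "elementary_sse_via E F R S \<longleftrightarrow>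
     is_matrix_product (verts E) (verts F) (verts E) (vertex_matrix E) R S \<and>
     is_matrix_product (verts F) (verts E) (verts F) (vertex_matrix F) S R"

fun imprimitivity_matrix ::
  "('v \<Rightarrow> 'w \<Rightarrow> nat) \<Rightarrow> ('w \<Rightarrow> 'v \<Rightarrow> nat) \<Rightarrow> 'v + 'w \<Rightarrow> 'v + 'w \<Rightarrow> nat" where
  "imprimitivity_matrix R S (Inl v) (Inl v') = 0"
| "imprimitivity_matrix R S (Inl v) (Inr w) = R v w"
| "imprimitivity_matrix R S (Inr w) (Inl v) = S w v"
| "imprimitivity_matrix R S (Inr w) (Inr w') = 0"

text \<open>
  The imprimitivity graph is determined by its vertex matrix up to the names of the arcs, which
  are left arbitrary.  It is not required to be connected or free of multiple edges: even if
  \<open>R S\<close> and \<open>S R\<close> are matrices of such graphs, \<open>R\<close> may have entries greater than \<open>1\<close> in columns that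
  belong to sinks of \<open>F\<close>.
\<close>
definition imprimitivity_graph ::
  "('v, 'e) pre_digraph \<Rightarrow> ('w, 'f) pre_digraph \<Rightarrow> ('v \<Rightarrow> 'w \<Rightarrow> nat) \<Rightarrow> ('w \<Rightarrow> 'v \<Rightarrow> nat)
     \<Rightarrow> ('v + 'w, 'x) pre_digraph \<Rightarrow> bool" where
  "imprimitivity_graph E F R S X \<longleftrightarrow>
     wf_digraph X \<and> verts X = verts E <+> verts F \<and>
     (\<forall>p\<in>verts X. \<forall>q\<in>verts X.
        finite (arcs_from_to X p q) \<and> vertex_matrix X p q = imprimitivity_matrix R S p q)"

lemma imprimitivity_graph_exists:
  "\<exists>X :: ('v + 'w, ('v + 'w) \<times> ('v + 'w) \<times> nat) pre_digraph. imprimitivity_graph E F R S X"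
proof -
  let ?V = "verts E <+> verts F"
  let ?B = "imprimitivity_matrix R S"
  let ?X = "\<lparr>verts = ?V, arcs = {(p, q, i). p \<in> ?V \<and> q \<in> ?V \<and> i < ?B p q},
             tail = fst, head = (\<lambda>a. fst (snd a))\<rparr>"
  have wf: "wf_digraph ?X"
    by unfold_locales auto
  have eq: "arcs_from_to ?X p q = (\<lambda>i. (p, q, i)) ` {..<?B p q}" if "p \<in> ?V" "q \<in> ?V" for p q
    using that by (auto simp: arcs_from_to_def)
  have "imprimitivity_graph E F R S ?X"
    unfolding imprimitivity_graph_def
  proof (intro conjI ballI)
    fix p q assume "p \<in> verts ?X" "q \<in> verts ?X"
    then have e: "arcs_from_to ?X p q = (\<lambda>i. (p, q, i)) ` {..<?B p q}"
      using eq by simp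
    show "finite (arcs_from_to ?X p q)"
      unfolding e by simp
    show "vertex_matrix ?X p q = ?B p q"
      unfolding vertex_matrix_def e by (subst card_image) (auto simp: inj_on_def)
  qed (use wf in simp_all)
  then show ?thesis by blast
qed


section \<open>Topological groupoids\<close>

record 'g topological_groupoid =
  elements :: "'g set"
  composable :: "'g \<Rightarrow> 'g \<Rightarrow> bool"
  compose :: "'g \<Rightarrow> 'g \<Rightarrow> 'g"
  invert :: "'g \<Rightarrow> 'g"
  gtopology :: "'g topology"

definition restrict_groupoid :: "'g topological_groupoid \<Rightarrow> 'g set \<Rightarrow> 'g topological_groupoid" where
  "restrict_groupoid \<G> C =
     \<G>\<lparr>elements := elements \<G> \<inter> C, gtopology := subtopology (gtopology \<G>) C\<rparr>"

definition groupoid_isomorphism ::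
  "'g topological_groupoid \<Rightarrow> 'h topological_groupoid \<Rightarrow> ('g \<Rightarrow> 'h) \<Rightarrow> bool" where
  "groupoid_isomorphism \<G> \<H> \<phi> \<longleftrightarrow>
     bij_betw \<phi> (elements \<G>) (elements \<H>) \<and>
     homeomorphic_map (gtopology \<G>) (gtopology \<H>) \<phi> \<and>
     (\<forall>g\<in>elements \<G>. \<phi> (invert \<G> g) = invert \<H> (\<phi> g)) \<and>
     (\<forall>g\<in>elements \<G>. \<forall>h\<in>elements \<G>. composable \<H> (\<phi> g) (\<phi> h) \<longleftrightarrow> composable \<G> g h) \<and>
     (\<forall>g\<in>elements \<G>. \<forall>h\<in>elements \<G>. composable \<G> g h \<longrightarrow>
        \<phi> (compose \<G> g h) = compose \<H> (\<phi> g) (\<phi> h))"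

definition groupoid_isomorphic ::
  "'g topological_groupoid \<Rightarrow> 'h topological_groupoid \<Rightarrow> bool" where
  "groupoid_isomorphic \<G> \<H> \<longleftrightarrow> (\<exists>\<phi>. groupoid_isomorphism \<G> \<H> \<phi>)"


section \<open>The path groupoid\<close>

text \<open>
  A finite path is a pair of its source and its list of arcs, so that the paths of length zero
  are the pairs \<open>(v, [])\<close>.
\<close>
definition fin_paths :: "('v, 'e) pre_digraph \<Rightarrow> ('v \<times> 'e list) set" where
  "fin_paths G = {(v, p). pre_digraph.awalk G v p (pre_digraph.awlast G v p)}"

definition path_range :: "('v, 'e) pre_digraph \<Rightarrow> 'v \<times> 'e list \<Rightarrow> 'v" where
  "path_range G \<alpha> = pre_digraph.awlast G (fst \<alpha>) (snd \<alpha>)"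

definition path_length :: "'v \<times> 'e list \<Rightarrow> nat" where
  "path_length \<alpha> = length (snd \<alpha>)"

definition inf_paths :: "('v, 'e) pre_digraph \<Rightarrow> 'e stream set" where
  "inf_paths G = {x. sset x \<subseteq> arcs G \<and> (\<forall>i. head G (x !! i) = tail G (x !! Suc i))}"

definition inf_source :: "('v, 'e) pre_digraph \<Rightarrow> 'e stream \<Rightarrow> 'v" where
  "inf_source G x = tail G (shd x)"

text \<open>
  The index \<open>i - k\<close> is nonnegative for all large \<open>i\<close>, so truncation by \<^const>\<open>nat\<close> is harmless;
  counting the arcs of a path from \<open>0\<close> instead of \<open>1\<close> does not affect the relation.
\<close>
definition shift_tail_equiv :: "'e stream \<Rightarrow> int \<Rightarrow> 'e stream \<Rightarrow> bool" where
  "shift_tail_equiv x k y \<longleftrightarrow> (\<forall>\<^sub>F i in sequentially. x !! i = y !! nat (int i - k))"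

type_synonym 'e path_triple = "'e stream \<times> int \<times> 'e stream"

definition path_groupoid_elements :: "('v, 'e) pre_digraph \<Rightarrow> 'e path_triple set" where
  "path_groupoid_elements G =
     {(x, k, y). x \<in> inf_paths G \<and> y \<in> inf_paths G \<and> shift_tail_equiv x k y}"

definition cylinder ::
  "('v, 'e) pre_digraph \<Rightarrow> 'v \<times> 'e list \<Rightarrow> 'v \<times> 'e list \<Rightarrow> 'e path_triple set" where
  "cylinder G \<alpha> \<beta> =
     {(snd \<alpha> @- x, int (path_length \<alpha>) - int (path_length \<beta>), snd \<beta> @- x) |x.
        x \<in> inf_paths G \<and> inf_source G x = path_range G \<alpha>}"

definition path_topology :: "('v, 'e) pre_digraph \<Rightarrow> 'e path_triple topology" where
  "path_topology G = topology_generated_by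
     {cylinder G \<alpha> \<beta> |\<alpha> \<beta>. \<alpha> \<in> fin_paths G \<and> \<beta> \<in> fin_paths G \<and> path_range G \<alpha> = path_range G \<beta>}"

lemma topspace_path_topology:
  assumes "wf_digraph G"
  shows "topspace (path_topology G) = path_groupoid_elements G"
proof -
  interpret wf_digraph G by fact
  have cas: "cas u p (awlast u p) \<longleftrightarrow> (p = [] \<or> tail G (hd p) = u) \<and>
      (\<forall>i. Suc i < length p \<longrightarrow> head G (p ! i) = tail G (p ! Suc i))" for u p
  proof (induction p arbitrary: u)
    case (Cons a p)
    have all: "(\<forall>i. P i) \<longleftrightarrow> P 0 \<and> (\<forall>i. P (Suc i))" for P :: "nat \<Rightarrow> bool"
      by (metis nat.exhaust)
    show ?case
      using Cons.IH[of "head G a"] by (cases p; subst all) auto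
  qed simp
  have last: "awlast u p = (if p = [] then u else head G (last p))" for u p
    by (induction p arbitrary: u) auto
  have in_inf: "p @- x \<in> inf_paths G"
    if "(u, p) \<in> fin_paths G" "x \<in> inf_paths G" "inf_source G x = path_range G (u, p)" for u p x
  proof -
    have p: "set p \<subseteq> arcs G" "\<And>i. Suc i < length p \<Longrightarrow> head G (p ! i) = tail G (p ! Suc i)"
      using that(1) cas[of u p] by (auto simp: fin_paths_def awalk_def)
    have x: "sset x \<subseteq> arcs G" "\<And>i. head G (x !! i) = tail G (x !! Suc i)"
      using that(2) by (auto simp: inf_paths_def)
    have "head G ((p @- x) !! i) = tail G ((p @- x) !! Suc i)" for i
    proof -
      consider "Suc i < length p" | "Suc i = length p" | "length p \<le> i" by linarith
      then show ?thesis
      proof cases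
        case 2
        then have "p \<noteq> []" "last p = p ! i" by (cases p; auto simp: last_conv_nth)+
        with 2 show ?thesis
          using that(3) last[of u p] by (simp add: inf_source_def path_range_def del: snth.simps(2))
      qed (use p x in \<open>simp_all add: Suc_diff_le del: snth.simps(2)\<close>)
    qed
    with p(1) x(1) show ?thesis by (auto simp: inf_paths_def)
  qed
  have sub: "cylinder G \<alpha> \<beta> \<subseteq> path_groupoid_elements G"
    if "\<alpha> \<in> fin_paths G" "\<beta> \<in> fin_paths G" "path_range G \<alpha> = path_range G \<beta>" for \<alpha> \<beta>
  proof -
    have "shift_tail_equiv (p @- x) (int (length p) - int (length q)) (q @- x)" for p q and x :: "'b stream"
      unfolding shift_tail_equiv_def eventually_sequentially
    proof (intro exI[of _ "length p"] allI impI)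
      fix i assume "length p \<le> i"
      moreover from this have "nat (int i - (int (length p) - int (length q))) = length q + (i - length p)"
        by linarith
      ultimately show "(p @- x) !! i = (q @- x) !! nat (int i - (int (length p) - int (length q)))"
        by simp
    qed
    with that in_inf show ?thesis
      by (cases \<alpha>; cases \<beta>) (auto simp: cylinder_def path_groupoid_elements_def path_length_def)
  qed
  have fin: "(inf_source G x, stake n x) \<in> fin_paths G \<and>
      path_range G (inf_source G x, stake n x) = inf_source G (sdrop n x) \<and>
      sdrop n x \<in> inf_paths G" if "x \<in> inf_paths G" for x n
  proof -
    have x: "\<And>i. x !! i \<in> arcs G" "\<And>i. head G (x !! i) = tail G (x !! Suc i)"
      using that by (auto simp: inf_paths_def)
    have "sdrop n x \<in> inf_paths G"
      using x by (auto simp: inf_paths_def sset_range sdrop_snth)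
    moreover have "path_range G (inf_source G x, stake n x) = inf_source G (sdrop n x)"
    proof (cases n)
      case (Suc m)
      have "last (stake n x) = x !! m"
        by (subst last_conv_nth) (simp_all add: Suc stake_nth del: stake.simps)
      moreover have "shd (sdrop n x) = x !! n"
        using sdrop_snth[of n x 0] by simp
      moreover have "stake n x \<noteq> []"
        by (simp add: Suc)
      ultimately show ?thesis
        using x(2)[of m] by (simp only: path_range_def last inf_source_def fst_conv snd_conv if_False Suc)
    qed (simp add: path_range_def inf_source_def)
    moreover have "set (stake n x) \<subseteq> arcs G"
      using x(1) by (auto simp: in_set_conv_nth)
    moreover have "stake n x = [] \<or> tail G (hd (stake n x)) = inf_source G x"
      by (cases n) (auto simp: inf_source_def)
    moreover have "inf_source G x \<in> verts G"
      using x(1)[of 0] by (simp add: inf_source_def)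
    ultimately show ?thesis
      using x(2) cas[of "inf_source G x" "stake n x"] by (auto simp: fin_paths_def awalk_def)
  qed
  have sup: "\<exists>\<alpha> \<beta>. \<alpha> \<in> fin_paths G \<and> \<beta> \<in> fin_paths G \<and> path_range G \<alpha> = path_range G \<beta> \<and>
      (x, k, y) \<in> cylinder G \<alpha> \<beta>" if "(x, k, y) \<in> path_groupoid_elements G" for x k y
  proof -
    have xy: "x \<in> inf_paths G" "y \<in> inf_paths G" "shift_tail_equiv x k y"
      using that by (auto simp: path_groupoid_elements_def)
    then obtain N where N: "\<And>i. N \<le> i \<Longrightarrow> x !! i = y !! nat (int i - k)"
      by (auto simp: shift_tail_equiv_def eventually_sequentially)
    define m where "m = N + nat \<bar>k\<bar>"
    define n where "n = nat (int m - k)"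
    have k: "k = int m - int n" "N \<le> m" unfolding m_def n_def by linarith+
    have "x !! (m + i) = y !! (n + i)" for i
    proof -
      have "nat (int (m + i) - k) = n + i" using k by linarith
      with N[of "m + i"] k(2) show ?thesis by simp
    qed
    then have eq: "sdrop m x = sdrop n y"
      using smap_alt[of id "sdrop m x" "sdrop n y"] by (simp add: stream.map_id sdrop_snth)
    let ?\<alpha> = "(inf_source G x, stake m x)" and ?\<beta> = "(inf_source G y, stake n y)"
    have "(x, k, y) \<in> cylinder G ?\<alpha> ?\<beta>"
      unfolding cylinder_def mem_Collect_eq using fin[OF xy(1), of m] eq k(1)
      by (intro exI[of _ "sdrop m x"])
         (metis fst_conv length_stake path_length_def snd_conv stake_sdrop)
    then show ?thesis using fin[OF xy(1), of m] fin[OF xy(2), of n] eq by metis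
  qed
  show ?thesis
    unfolding path_topology_def topology_generated_by_topspace using sub sup by fastforce
qed

definition path_groupoid :: "('v, 'e) pre_digraph \<Rightarrow> 'e path_triple topological_groupoid" where
  "path_groupoid G =
     \<lparr>elements = path_groupoid_elements G,
      composable = (\<lambda>(x, k, y) (y', l, z). y = y'),
      compose = (\<lambda>(x, k, y) (y', l, z). (x, k + l, z)),
      invert = (\<lambda>(x, k, y). (y, - k, x)),
      gtopology = path_topology G\<rparr>"

definition pointed_groupoid ::
  "('v, 'e) pre_digraph \<Rightarrow> 'v set \<Rightarrow> 'e path_triple topological_groupoid" where
  "pointed_groupoid X S\<^sub>0 =
     restrict_groupoid (path_groupoid X) {(x, k, y). inf_source X x \<in> S\<^sub>0 \<and> inf_source X y \<in> S\<^sub>0}"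

end

theory Submission
  imports Defs
begin

text \<open>
  Every step of a path in \<open>X\<close> changes sides between \<open>E\<^sup>0\<close> and \<open>F\<^sup>0\<close>, and \<open>B\<^sub>E = R S\<close> provides a
  bijection between the arcs of \<open>E\<close> and the paths of length two in \<open>X\<close> that start in \<open>E\<^sup>0\<close>.
  Replacing each arc by the corresponding pair identifies the infinite paths of \<open>E\<close> with those of
  \<open>X\<close> that start in \<open>E\<^sup>0\<close>.  Two paths of the latter kind can only be tail equivalent with an even
  lag, so halving the lag gives the isomorphism of groupoids.  It is a homeomorphism because
  cylinders of odd length in \<open>X\<close> are unions of cylinders of even length.
\<close>

section \<open>Neighbourhoods in the path groupoid\<close>

text \<open>All conditions on paths below are stated by position; rewriting
  \<open>x !! Suc i\<close> to \<open>stl x !! i\<close> would destroy that form.\<close>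

declare snth.simps [simp del]

section \<open>Infinite paths and their initial segments\<close>

lemma stream_eqI: "(\<And>i. x !! i = y !! i) \<Longrightarrow> x = y"
  using smap_alt[of id x y] by (simp add: stream.map_id)

lemma inf_paths_iff_snth:
  "x \<in> inf_paths G \<longleftrightarrow> (\<forall>i. x !! i \<in> arcs G \<and> head G (x !! i) = tail G (x !! Suc i))"
  by (simp add: inf_paths_def sset_range image_subset_iff all_conj_distrib)

lemma inf_source_snth: "inf_source G x = tail G (x !! 0)"
  by (simp add: inf_source_def snth.simps)

lemma sdrop_in_inf_paths: "x \<in> inf_paths G \<Longrightarrow> sdrop n x \<in> inf_paths G"
  by (simp add: inf_paths_iff_snth sdrop_snth)

lemma (in wf_digraph) awalk_stake:
  "x \<in> inf_paths G \<Longrightarrow> awalk (inf_source G x) (stake n x) (inf_source G (sdrop n x))"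
proof (induction n arbitrary: x)
  case 0
  then have "x !! 0 \<in> arcs G"
    unfolding inf_paths_iff_snth by blast
  then show ?case
    by (simp add: awalk_Nil_iff inf_source_snth)
next
  case (Suc n)
  have "stl x \<in> inf_paths G"
    using sdrop_in_inf_paths[OF Suc.prems, of 1] by simp
  note Suc.IH[OF this]
  moreover have "x !! 0 \<in> arcs G" "head G (x !! 0) = tail G (x !! 1)"
    using Suc.prems unfolding inf_paths_iff_snth One_nat_def by blast+
  ultimately show ?case
    by (simp add: awalk_Cons_iff inf_source_def snth.simps)
qed

lemma (in wf_digraph)
  assumes "x \<in> inf_paths G"
  shows stake_in_fin_paths: "(inf_source G x, stake n x) \<in> fin_paths G"
    and path_range_stake: "path_range G (inf_source G x, stake n x) = inf_source G (sdrop n x)"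
  using awalk_stake[OF assms, of n] by (auto simp: fin_paths_def path_range_def)

text \<open>Two starting positions replace the integer lag, which is recovered as
  \<open>int m - int n\<close>. This avoids the truncated subtraction of
  \<open>shift_tail_equiv\<close> and keeps the prefix lengths that cylinders need.\<close>

definition tails_match :: "'e stream \<Rightarrow> nat \<Rightarrow> 'e stream \<Rightarrow> nat \<Rightarrow> bool" where
  "tails_match x m y n \<longleftrightarrow> (\<forall>i. x !! (m + i) = y !! (n + i))"

lemma tails_match_add: "tails_match x m y n \<Longrightarrow> tails_match x (m + j) y (n + j)"
  by (simp add: tails_match_def add.assoc)

text \<open>Matching tails still match after both positions advance by the same amount, so positions
  can always be taken positive. Positivity is what lets prefixes determine the sources later
  on.\<close>

lemma shift_tail_equiv_iff_tails_match:
  "shift_tail_equiv x k y \<longleftrightarrow>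
     (\<exists>m n. 0 < m \<and> 0 < n \<and> k = int m - int n \<and> tails_match x m y n)"
proof
  assume "shift_tail_equiv x k y"
  then obtain N where N: "\<And>i. N \<le> i \<Longrightarrow> x !! i = y !! nat (int i - k)"
    by (auto simp: shift_tail_equiv_def eventually_sequentially)
  \<comment> \<open>The summand \<open>N\<close> passes the threshold, the absolute value keeps
    \<open>int m - k\<close> nonnegative, and the final 1 makes both positions positive.\<close>
  define m where "m = N + nat \<bar>k\<bar> + 1"
  define n where "n = nat (int m - k)"
  have k: "0 < m" "0 < n" "k = int m - int n" "N \<le> m"
    unfolding m_def n_def by linarith+
  have "x !! (m + i) = y !! (n + i)" for i
  proof -
    have "nat (int (m + i) - k) = n + i"
      using k by linarith
    with N[of "m + i"] k show ?thesis by simp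
  qed
  with k show "\<exists>m n. 0 < m \<and> 0 < n \<and> k = int m - int n \<and> tails_match x m y n"
    unfolding tails_match_def by blast
next
  assume "\<exists>m n. 0 < m \<and> 0 < n \<and> k = int m - int n \<and> tails_match x m y n"
  then obtain m n where mn: "k = int m - int n" "tails_match x m y n"
    by blast
  have "x !! i = y !! nat (int i - k)" if "m \<le> i" for i
  proof -
    have "nat (int i - k) = n + (i - m)"
      using that mn(1) by linarith
    then show ?thesis
      using mn(2) that unfolding tails_match_def by (metis le_add_diff_inverse)
  qed
  then show "shift_tail_equiv x k y"
    unfolding shift_tail_equiv_def eventually_sequentially by blast
qed

text \<open>
  For positive \<open>m\<close> and \<open>n\<close> this is the cylinder of the initial segments of \<open>x\<close> and \<open>y\<close> of lengths
  \<open>m\<close> and \<open>n\<close>; for \<open>m = n = 0\<close> it would not fix the source.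
\<close>
definition pair_nbhd ::
  "('v, 'e) pre_digraph \<Rightarrow> 'e stream \<Rightarrow> nat \<Rightarrow> 'e stream \<Rightarrow> nat \<Rightarrow> 'e path_triple set" where
  "pair_nbhd G x m y n =
     {(x', k, y'). x' \<in> inf_paths G \<and> y' \<in> inf_paths G \<and> k = int m - int n \<and>
        (\<forall>i<m. x' !! i = x !! i) \<and> (\<forall>i<n. y' !! i = y !! i) \<and> tails_match x' m y' n}"

text \<open>Longer prefixes give a smaller set: on the next \<open>j\<close> places x' and y' agree
  because they copy x and y, whose tails match there, and beyond those places they agree by
  assumption.\<close>

lemma pair_nbhd_add: "tails_match x m y n \<Longrightarrow> pair_nbhd G x (m + j) y (n + j) \<subseteq> pair_nbhd G x m y n"
proof (clarsimp simp: pair_nbhd_def)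
  fix x' y'
  assume *: "tails_match x m y n" "\<forall>i<m + j. x' !! i = x !! i" "\<forall>i<n + j. y' !! i = y !! i"
    "tails_match x' (m + j) y' (n + j)"
  have "x' !! (m + i) = y' !! (n + i)" for i
  proof (cases "i < j")
    case False
    then obtain l where "i = j + l"
      by (metis le_add_diff_inverse not_le)
    then show ?thesis
      using *(4) by (simp add: tails_match_def add.assoc)
  qed (use * in \<open>simp add: tails_match_def\<close>)
  then show "tails_match x' m y' n"
    by (simp add: tails_match_def)
qed

section \<open>Open sets described by neighbourhoods\<close>

definition nbhd_open :: "('v, 'e) pre_digraph \<Rightarrow> 'e path_triple set \<Rightarrow> bool" where
  "nbhd_open G U \<longleftrightarrow>
     (\<forall>(x, k, y)\<in>U. \<exists>m n. 0 < m \<and> 0 < n \<and> k = int m - int n \<and> tails_match x m y n \<and>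
        pair_nbhd G x m y n \<subseteq> U)"

lemma nbhd_openE:
  assumes "nbhd_open G U" "(x, k, y) \<in> U"
  obtains m n where "0 < m" "0 < n" "k = int m - int n" "tails_match x m y n"
    "pair_nbhd G x m y n \<subseteq> U"
  using bspec[OF assms(1)[unfolded nbhd_open_def] assms(2)] that by auto

text \<open>Both pairs of lengths have the difference \<open>k\<close>, so prolonging the first by
  \<open>m'\<close> and the second by \<open>m\<close> produces the same pair.\<close>

lemma nbhd_open_Int:
  assumes "nbhd_open G U" "nbhd_open G V"
  shows "nbhd_open G (U \<inter> V)"
  unfolding nbhd_open_def
proof (clarsimp)
  fix x k y assume "(x, k, y) \<in> U" "(x, k, y) \<in> V"
  obtain m n where 1: "0 < m" "0 < n" "k = int m - int n" "tails_match x m y n"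
    "pair_nbhd G x m y n \<subseteq> U"
    by (rule nbhd_openE[OF assms(1) \<open>(x, k, y) \<in> U\<close>])
  obtain m' n' where 2: "0 < m'" "0 < n'" "k = int m' - int n'" "tails_match x m' y n'"
    "pair_nbhd G x m' y n' \<subseteq> V"
    by (rule nbhd_openE[OF assms(2) \<open>(x, k, y) \<in> V\<close>])
  have eq: "n + m' = n' + m"
    using 1(3) 2(3) by linarith
  have "pair_nbhd G x (m + m') y (n + m') \<subseteq> U"
    using pair_nbhd_add[OF 1(4), of G m'] 1(5) by blast
  moreover have "pair_nbhd G x (m + m') y (n + m') \<subseteq> V"
    using pair_nbhd_add[OF 2(4), of G m] 2(5) unfolding eq by (simp add: add.commute)
  ultimately show "\<exists>m. 0 < m \<and> (\<exists>n. 0 < n \<and> k = int m - int n \<and> tails_match x m y n \<and>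
      pair_nbhd G x m y n \<subseteq> U \<and> pair_nbhd G x m y n \<subseteq> V)"
    using 1(1-3) tails_match_add[OF 1(4), of m']
    by (intro exI[of _ "m + m'"] conjI exI[of _ "n + m'"]) auto
qed

lemma nbhd_open_cylinder: "nbhd_open G (cylinder G \<alpha> \<beta>)"
  unfolding nbhd_open_def
proof clarify
  fix x k y assume "(x, k, y) \<in> cylinder G \<alpha> \<beta>"
  then obtain z where z: "z \<in> inf_paths G" "inf_source G z = path_range G \<alpha>"
    and x: "x = snd \<alpha> @- z" and y: "y = snd \<beta> @- z"
    and k: "k = int (path_length \<alpha>) - int (path_length \<beta>)"
    by (auto simp: cylinder_def)
  let ?m = "path_length \<alpha>" and ?n = "path_length \<beta>"
  \<comment> \<open>One arc beyond each of the two paths is prescribed, so the arc at position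
    \<open>?m\<close> is the first arc of \<open>z\<close> and starts at the range of \<alpha>.
    Prefixes of the exact lengths would say nothing about that vertex when both paths have length
    zero.\<close>
  have "pair_nbhd G x (Suc ?m) y (Suc ?n) \<subseteq> cylinder G \<alpha> \<beta>"
  proof (clarsimp simp: pair_nbhd_def)
    fix x' y'
    assume *: "x' \<in> inf_paths G" "y' \<in> inf_paths G" "\<forall>i<Suc ?m. x' !! i = x !! i"
      "\<forall>i<Suc ?n. y' !! i = y !! i" "tails_match x' (Suc ?m) y' (Suc ?n)"
    have mid: "x' !! ?m = z !! 0" "y' !! ?n = z !! 0"
      using *(3,4) by (simp_all add: x y path_length_def)
    have "x' = snd \<alpha> @- sdrop ?m x'"
    proof (rule stream_eqI)
      show "x' !! i = (snd \<alpha> @- sdrop ?m x') !! i" for i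
        using *(3) by (cases "i < ?m") (simp_all add: x path_length_def sdrop_snth)
    qed
    moreover have "y' = snd \<beta> @- sdrop ?m x'"
    proof (rule stream_eqI)
      fix i
      consider "i < ?n" | "i = ?n" | j where "i = Suc ?n + j"
        by (metis less_imp_Suc_add linorder_neqE_nat add_Suc)
      then show "y' !! i = (snd \<beta> @- sdrop ?m x') !! i"
      proof cases
        case 1
        then show ?thesis
          using *(4) by (simp add: y path_length_def)
      next
        case 2
        then show ?thesis
          using mid by (simp add: path_length_def sdrop_snth)
      next
        case 3
        then have "y' !! i = x' !! (Suc ?m + j)"
          using *(5) by (simp add: tails_match_def)
        with 3 show ?thesis
          by (simp add: path_length_def sdrop_snth Suc_diff_le)
      qed
    qed
    moreover have "inf_source G (sdrop ?m x') = path_range G \<alpha>"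
      using z(2) mid(1) by (simp add: inf_source_snth sdrop_snth)
    ultimately show "(x', int ?m - int ?n, y') \<in> cylinder G \<alpha> \<beta>"
      unfolding cylinder_def using sdrop_in_inf_paths[OF *(1)] by blast
  qed
  moreover have "tails_match x ?m y ?n"
    by (simp add: tails_match_def x y path_length_def)
  then have "tails_match x (Suc ?m) y (Suc ?n)"
    using tails_match_add[of x ?m y ?n 1] by simp
  ultimately show "\<exists>m n. 0 < m \<and> 0 < n \<and> k = int m - int n \<and> tails_match x m y n \<and>
      pair_nbhd G x m y n \<subseteq> cylinder G \<alpha> \<beta>"
    using k by (intro exI[of _ "Suc ?m"] exI[of _ "Suc ?n"]) simp
qed

text \<open>The sets satisfying \<open>nbhd_open\<close> form a topology that contains the
  cylinders, hence every set of the generated topology. Conversely, the cylinder of suitable initial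
  segments of a point is contained in its \<open>pair_nbhd\<close>. Since \<open>nbhd_open\<close>
  by itself does not confine a set to the groupoid, the inclusion is a separate conjunct.\<close>

lemma openin_path_topology_iff:
  assumes "wf_digraph G"
  shows "openin (path_topology G) U \<longleftrightarrow> U \<subseteq> path_groupoid_elements G \<and> nbhd_open G U"
proof (intro iffI conjI)
  assume U: "openin (path_topology G) U"
  then show "U \<subseteq> path_groupoid_elements G"
    using openin_subset topspace_path_topology[OF assms] by metis
  have ist: "istopology (nbhd_open G)"
    unfolding istopology_def
  proof (intro conjI allI impI)
    fix \<K> assume \<K>: "\<forall>K\<in>\<K>. nbhd_open G K"
    show "nbhd_open G (\<Union>\<K>)"
      unfolding nbhd_open_def
    proof clarify
      fix x k y K assume K: "(x, k, y) \<in> K" "K \<in> \<K>"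
      then obtain m n where "0 < m" "0 < n" "k = int m - int n" "tails_match x m y n"
        "pair_nbhd G x m y n \<subseteq> K"
        using \<K> by (blast elim: nbhd_openE)
      with K show "\<exists>m n. 0 < m \<and> 0 < n \<and> k = int m - int n \<and> tails_match x m y n \<and>
          pair_nbhd G x m y n \<subseteq> \<Union>\<K>"
        by blast
    qed
  qed (rule nbhd_open_Int)
  show "nbhd_open G U"
    by (rule generate_topology_on_coarsest[OF ist _
          openin_topology_generated_by[OF U[unfolded path_topology_def]]])
      (auto intro: nbhd_open_cylinder)
next
  interpret wf_digraph G by fact
  assume U: "U \<subseteq> path_groupoid_elements G \<and> nbhd_open G U"
  show "openin (path_topology G) U"
  proof (rule openin_subopen[THEN iffD2], rule ballI, clarify)
    fix x k y assume xky: "(x, k, y) \<in> U"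
    with U obtain m n where mn: "0 < m" "0 < n" "k = int m - int n" "tails_match x m y n"
      "pair_nbhd G x m y n \<subseteq> U"
      by (blast elim: nbhd_openE)
    have xy: "x \<in> inf_paths G" "y \<in> inf_paths G"
      using xky U by (auto simp: path_groupoid_elements_def)
    let ?\<alpha> = "(inf_source G x, stake m x)" and ?\<beta> = "(inf_source G y, stake n y)"
    have eq: "sdrop m x = sdrop n y"
      using mn(4) by (intro stream_eqI) (simp add: sdrop_snth tails_match_def)
    have op: "openin (path_topology G) (cylinder G ?\<alpha> ?\<beta>)"
      unfolding path_topology_def
      using stake_in_fin_paths[OF xy(1), of m] stake_in_fin_paths[OF xy(2), of n]
        path_range_stake[OF xy(1), of m] path_range_stake[OF xy(2), of n] eq
      by (intro topology_generated_by_Basis CollectI exI[of _ ?\<alpha>] exI[of _ ?\<beta>]) simp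
    then have "cylinder G ?\<alpha> ?\<beta> \<subseteq> path_groupoid_elements G"
      using openin_subset topspace_path_topology[OF assms] by metis
    moreover have "(x', k', y') \<in> pair_nbhd G x m y n"
      if "(x', k', y') \<in> cylinder G ?\<alpha> ?\<beta>" "(x', k', y') \<in> path_groupoid_elements G" for x' k' y'
      using that by (auto simp: cylinder_def pair_nbhd_def path_groupoid_elements_def
          path_length_def tails_match_def)
    ultimately have "cylinder G ?\<alpha> ?\<beta> \<subseteq> U"
      using mn(5) by (auto simp: subset_iff)
    moreover have "(x, k, y) \<in> cylinder G ?\<alpha> ?\<beta>"
      unfolding cylinder_def mem_Collect_eq
      using path_range_stake[OF xy(1), of m] sdrop_in_inf_paths[OF xy(1), of m] mn(3) eq
      by (intro exI[of _ "sdrop m x"])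
         (metis length_stake path_length_def snd_conv stake_sdrop)
    ultimately show "\<exists>T. openin (path_topology G) T \<and> (x, k, y) \<in> T \<and> T \<subseteq> U"
      using op by blast
  qed
qed


lemma pair_nbhd_subset_elements:
  "0 < m \<Longrightarrow> 0 < n \<Longrightarrow> pair_nbhd G x m y n \<subseteq> path_groupoid_elements G"
  by (auto simp: pair_nbhd_def path_groupoid_elements_def shift_tail_equiv_iff_tails_match)


section \<open>Replacing arcs by paths of length two\<close>

text \<open>This is the situation of one side of the imprimitivity graph, with \<iota> standing for
  \<open>Inl\<close> or \<open>Inr\<close>. The other side enters only as the complement of the
  image of \<iota>, and \<open>alternating\<close> expresses that \<open>X\<close> is
  bipartite.\<close>

locale arc_pairing = G: wf_digraph G + X: wf_digraph X
  for G :: "('v, 'e) pre_digraph" and X :: "('u, 'x) pre_digraph" +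
  fixes \<iota> :: "'v \<Rightarrow> 'u" and pr :: "'e \<Rightarrow> 'x \<times> 'x"
  assumes inj_vertex: "inj_on \<iota> (verts G)"
    and bij_pr: "bij_betw pr (arcs G)
      {(a, b). a \<in> arcs X \<and> b \<in> arcs X \<and> head X a = tail X b \<and> tail X a \<in> \<iota> ` verts G}"
    and tail_pr: "e \<in> arcs G \<Longrightarrow> tail X (fst (pr e)) = \<iota> (tail G e)"
    and head_pr: "e \<in> arcs G \<Longrightarrow> head X (snd (pr e)) = \<iota> (head G e)"
    and alternating: "a \<in> arcs X \<Longrightarrow> head X a \<in> \<iota> ` verts G \<longleftrightarrow> tail X a \<notin> \<iota> ` verts G"
begin

section \<open>Doubling and halving of infinite paths\<close>

definition double :: "'e stream \<Rightarrow> 'x stream" where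
  "double u = smap (\<lambda>n. (if even n then fst else snd) (pr (u !! (n div 2)))) nats"

text \<open>The value of \<open>inv_into\<close> is meaningful only for pairs in the image of
  \<open>pr\<close>, that is, for paths in \<open>pointed_paths\<close>.\<close>

definition halve :: "'x stream \<Rightarrow> 'e stream" where
  "halve x = smap (\<lambda>n. inv_into (arcs G) pr (x !! (2 * n), x !! Suc (2 * n))) nats"

lemma double_snth: "double u !! n = (if even n then fst else snd) (pr (u !! (n div 2)))"
  by (simp add: double_def)

lemma halve_snth: "halve x !! n = inv_into (arcs G) pr (x !! (2 * n), x !! Suc (2 * n))"
  by (simp add: halve_def)

definition pointed_paths :: "'x stream set" where
  "pointed_paths = {x \<in> inf_paths X. inf_source X x \<in> \<iota> ` verts G}"

lemma pr_arcs:
  assumes "e \<in> arcs G"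
  shows "fst (pr e) \<in> arcs X" "snd (pr e) \<in> arcs X" "head X (fst (pr e)) = tail X (snd (pr e))"
  using bij_betwE[OF bij_pr] assms by force+

lemma inj_pr: "inj_on pr (arcs G)"
  using bij_pr by (rule bij_betw_imp_inj_on)

lemma tail_snth_iff:
  assumes "x \<in> pointed_paths"
  shows "tail X (x !! i) \<in> \<iota> ` verts G \<longleftrightarrow> even i"
proof (induction i)
  case 0
  then show ?case
    using assms by (simp add: pointed_paths_def inf_source_snth)
next
  case (Suc i)
  have "x !! i \<in> arcs X" "head X (x !! i) = tail X (x !! Suc i)"
    using assms unfolding pointed_paths_def inf_paths_iff_snth by blast+
  then show ?case
    using alternating[of "x !! i"] Suc by (simp)
qed

lemma double_in_pointed_paths:
  assumes "u \<in> inf_paths G"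
  shows "double u \<in> pointed_paths"
proof -
  have u: "u !! i \<in> arcs G" "head G (u !! i) = tail G (u !! Suc i)" for i
    using assms unfolding inf_paths_iff_snth by blast+
  \<comment> \<open>For even \<open>i\<close> the two arcs form one pair. For odd \<open>i\<close>
    they come from consecutive arcs of \<open>G\<close>, and \<open>head_pr\<close> and
    \<open>tail_pr\<close> identify the vertex where these meet.\<close>
  have "head X (double u !! i) = tail X (double u !! Suc i)" for i
    using u[of "i div 2"] u(1)[of "Suc (i div 2)"] pr_arcs(3)[OF u(1)[of "i div 2"]] head_pr tail_pr
    by (cases "even i") (simp_all add: double_snth)
  moreover have "double u !! i \<in> arcs X" for i
    using pr_arcs u(1) by (simp add: double_snth)
  moreover have "inf_source X (double u) \<in> \<iota> ` verts G"
    using tail_pr[OF u(1)[of 0]] u(1)[of 0] by (simp add: inf_source_snth double_snth)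
  ultimately show ?thesis
    unfolding pointed_paths_def inf_paths_iff_snth by blast
qed

lemma pr_halve:
  assumes "x \<in> pointed_paths"
  shows "halve x !! i \<in> arcs G" "pr (halve x !! i) = (x !! (2 * i), x !! Suc (2 * i))"
proof -
  have "x !! j \<in> arcs X" "head X (x !! j) = tail X (x !! Suc j)" for j
    using assms unfolding pointed_paths_def inf_paths_iff_snth by blast+
  then have "(x !! (2 * i), x !! Suc (2 * i)) \<in> pr ` arcs G"
    using tail_snth_iff[OF assms, of "2 * i"] unfolding bij_betw_imp_surj_on[OF bij_pr] by simp
  then show "halve x !! i \<in> arcs G" "pr (halve x !! i) = (x !! (2 * i), x !! Suc (2 * i))"
    unfolding halve_snth by (rule inv_into_into, rule f_inv_into_f)
qed

lemma halve_in_inf_paths: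
  assumes "x \<in> pointed_paths"
  shows "halve x \<in> inf_paths G"
  unfolding inf_paths_iff_snth
proof (intro allI conjI)
  fix i
  note h = pr_halve[OF assms]
  show "halve x !! i \<in> arcs G"
    by (rule h)
  have "head X (x !! Suc (2 * i)) = tail X (x !! (2 * Suc i))"
    using assms unfolding pointed_paths_def inf_paths_iff_snth by simp
  \<comment> \<open>Adjacency in \<open>X\<close> compares the two vertices only after \<iota>;
    injectivity brings the equation back to \<open>G\<close>.\<close>
  then have "\<iota> (head G (halve x !! i)) = \<iota> (tail G (halve x !! Suc i))"
    using head_pr[OF h(1), of i] tail_pr[OF h(1), of "Suc i"] by (simp add: h(2))
  then show "head G (halve x !! i) = tail G (halve x !! Suc i)"
    using inj_onD[OF inj_vertex] G.head_in_verts[OF h(1)] G.tail_in_verts[OF h(1)] by blast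
qed

lemma double_halve: "x \<in> pointed_paths \<Longrightarrow> double (halve x) = x"
  by (rule stream_eqI) (simp add: double_snth pr_halve)

lemma halve_double:
  assumes "u \<in> inf_paths G"
  shows "halve (double u) = u"
proof (rule stream_eqI)
  fix i
  have "u !! i \<in> arcs G"
    using assms unfolding inf_paths_iff_snth by blast
  then show "halve (double u) !! i = u !! i"
    by (simp add: halve_snth double_snth inv_into_f_f[OF inj_pr])
qed

section \<open>Prefixes, tails and lags under doubling\<close>

lemma snth_eq_iff_double:
  assumes "u \<in> inf_paths G" "w \<in> inf_paths G"
  shows "u !! i = w !! j \<longleftrightarrow>
    double u !! (2 * i) = double w !! (2 * j) \<and> double u !! Suc (2 * i) = double w !! Suc (2 * j)"
proof -
  have "u !! i \<in> arcs G" "w !! j \<in> arcs G"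
    using assms unfolding inf_paths_iff_snth by blast+
  then have "u !! i = w !! j \<longleftrightarrow> pr (u !! i) = pr (w !! j)"
    using inj_on_eq_iff[OF inj_pr] by metis
  then show ?thesis
    by (simp add: double_snth prod_eq_iff)
qed

lemma prefix_eq_double:
  assumes "u \<in> inf_paths G" "w \<in> inf_paths G"
  shows "(\<forall>i<2 * m. double u !! i = double w !! i) \<longleftrightarrow> (\<forall>i<m. u !! i = w !! i)"
proof (intro iffI allI impI)
  fix i assume "\<forall>i<2 * m. double u !! i = double w !! i" "i < m"
  then show "u !! i = w !! i"
    unfolding snth_eq_iff_double[OF assms] by simp
next
  fix i assume "\<forall>i<m. u !! i = w !! i" "i < 2 * m"
  then show "double u !! i = double w !! i"
    by (simp add: double_snth less_mult_imp_div_less mult.commute)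
qed

lemma tails_match_double:
  assumes "u \<in> inf_paths G" "w \<in> inf_paths G"
  shows "tails_match (double u) (2 * m) (double w) (2 * n) \<longleftrightarrow> tails_match u m w n"
proof
  assume *: "tails_match (double u) (2 * m) (double w) (2 * n)"
  have "u !! (m + i) = w !! (n + i)" for i
    unfolding snth_eq_iff_double[OF assms]
    using *[unfolded tails_match_def, rule_format, of "2 * i"]
      *[unfolded tails_match_def, rule_format, of "Suc (2 * i)"]
    by (simp add: distrib_left)
  then show "tails_match u m w n"
    by (simp add: tails_match_def)
qed (simp add: tails_match_def double_snth)

text \<open>The arcs \<open>x !! m\<close> and \<open>y !! n\<close> coincide, so their sources lie
  on the same side of \<open>X\<close>, and the parity of a position determines the side. This is
  why lags are even.\<close>

lemma tails_match_parity:
  "tails_match x m y n \<Longrightarrow> x \<in> pointed_paths \<Longrightarrow> y \<in> pointed_paths \<Longrightarrow> even m \<longleftrightarrow> even n"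
  using tail_snth_iff unfolding tails_match_def by (metis add.right_neutral)

text \<open>Lengthening the initial segments makes both lengths even.\<close>
lemma tails_match_evenE:
  assumes "tails_match (double u) m (double w) n" "u \<in> inf_paths G" "w \<in> inf_paths G"
    and "k = int m - int n"
  obtains n' where "n + m = 2 * n'" "k = 2 * (int m - int n')" "tails_match u m w n'"
proof -
  have "even (n + m)"
    using tails_match_parity[OF assms(1)] double_in_pointed_paths assms(2,3) by simp
  then obtain n' where n': "n + m = 2 * n'"
    by (rule evenE)
  have "tails_match (double u) (m + m) (double w) (n + m)"
    by (rule tails_match_add) fact
  then have "tails_match u m w n'"
    using tails_match_double[OF assms(2,3)] unfolding n' by (simp add: mult_2)
  moreover have "k = 2 * (int m - int n')"
    using arg_cong[OF n', of int] assms(4) by simp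
  ultimately show thesis
    using n' that by blast
qed

lemma shift_tail_equiv_double:
  assumes "u \<in> inf_paths G" "w \<in> inf_paths G"
  shows "shift_tail_equiv (double u) k (double w) \<longleftrightarrow> even k \<and> shift_tail_equiv u (k div 2) w"
proof
  assume "shift_tail_equiv (double u) k (double w)"
  then obtain m n where mn: "0 < m" "k = int m - int n" "tails_match (double u) m (double w) n"
    unfolding shift_tail_equiv_iff_tails_match by blast
  obtain n' where n': "n + m = 2 * n'" "k = 2 * (int m - int n')" "tails_match u m w n'"
    by (rule tails_match_evenE[OF mn(3) assms mn(2)])
  \<comment> \<open>Since \<open>m\<close> is positive, \<open>n + m = 2 * n'\<close> makes
    \<open>n'\<close> positive as well.\<close>
  then show "even k \<and> shift_tail_equiv u (k div 2) w"
    unfolding shift_tail_equiv_iff_tails_match using mn(1)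
    by (intro conjI exI[of _ m] exI[of _ n']) auto
next
  assume "even k \<and> shift_tail_equiv u (k div 2) w"
  then obtain m n where "even k" and mn: "0 < m" "0 < n" "k div 2 = int m - int n" "tails_match u m w n"
    unfolding shift_tail_equiv_iff_tails_match by blast
  then show "shift_tail_equiv (double u) k (double w)"
    unfolding shift_tail_equiv_iff_tails_match using tails_match_double[OF assms]
    by (intro exI[of _ "2 * m"] exI[of _ "2 * n"]) auto
qed

section \<open>Doubling and halving of groupoid elements\<close>

definition double_triple :: "'e path_triple \<Rightarrow> 'x path_triple" where
  "double_triple = (\<lambda>(u, k, w). (double u, 2 * k, double w))"

text \<open>By \<open>pointed_elements_even\<close>, the integer division is exact on
  \<open>pointed_elements\<close>.\<close>

definition halve_triple :: "'x path_triple \<Rightarrow> 'e path_triple" where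
  "halve_triple = (\<lambda>(x, k, y). (halve x, k div 2, halve y))"

definition pointed_elements :: "'x path_triple set" where
  "pointed_elements =
     path_groupoid_elements X \<inter> {(x, k, y). inf_source X x \<in> \<iota> ` verts G \<and> inf_source X y \<in> \<iota> ` verts G}"

lemma pointed_elements_iff:
  "(x, k, y) \<in> pointed_elements \<longleftrightarrow>
     x \<in> pointed_paths \<and> y \<in> pointed_paths \<and> shift_tail_equiv x k y"
  by (auto simp: pointed_elements_def pointed_paths_def path_groupoid_elements_def)

lemma pointed_elements_even: "(x, k, y) \<in> pointed_elements \<Longrightarrow> even k"
  using shift_tail_equiv_double[of "halve x" "halve y" k]
  by (simp add: pointed_elements_iff double_halve halve_in_inf_paths)

lemma double_triple_in: "z \<in> path_groupoid_elements G \<Longrightarrow> double_triple z \<in> pointed_elements"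
  by (cases z) (auto simp: path_groupoid_elements_def double_triple_def pointed_elements_iff
      double_in_pointed_paths shift_tail_equiv_double)

lemma halve_triple_in: "g \<in> pointed_elements \<Longrightarrow> halve_triple g \<in> path_groupoid_elements G"
proof (cases g)
  case (fields x k y)
  assume "g \<in> pointed_elements"
  then show ?thesis
    using shift_tail_equiv_double[of "halve x" "halve y" k] fields
    by (simp add: path_groupoid_elements_def halve_triple_def pointed_elements_iff double_halve
        halve_in_inf_paths)
qed

lemma halve_double_triple: "z \<in> path_groupoid_elements G \<Longrightarrow> halve_triple (double_triple z) = z"
  by (auto simp: path_groupoid_elements_def halve_triple_def double_triple_def halve_double)

lemma double_halve_triple: "g \<in> pointed_elements \<Longrightarrow> double_triple (halve_triple g) = g"
proof (cases g)
  case (fields x k y)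
  assume "g \<in> pointed_elements"
  then show ?thesis
    using pointed_elements_even[of x k y]
    by (simp add: fields pointed_elements_iff halve_triple_def double_triple_def double_halve)
qed

text \<open>Both continuity proofs rest on this: neighbourhoods of even lengths in \<open>X\<close>
  correspond exactly to neighbourhoods of half the lengths in \<open>G\<close>.\<close>

lemma double_triple_in_pair_nbhd_iff:
  assumes "u \<in> inf_paths G" "w \<in> inf_paths G" "z \<in> path_groupoid_elements G"
  shows "double_triple z \<in> pair_nbhd X (double u) (2 * m) (double w) (2 * n) \<longleftrightarrow>
    z \<in> pair_nbhd G u m w n"
proof (cases z)
  case (fields u' k w')
  then have "u' \<in> inf_paths G" "w' \<in> inf_paths G"
    using assms(3) by (auto simp: path_groupoid_elements_def)
  moreover from this have "double u' \<in> inf_paths X" "double w' \<in> inf_paths X"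
    using double_in_pointed_paths by (auto simp: pointed_paths_def)
  moreover have "2 * k = int (2 * m) - int (2 * n) \<longleftrightarrow> k = int m - int n"
    by linarith
  ultimately show ?thesis
    using assms(1,2)
    by (simp add: fields double_triple_def pair_nbhd_def prefix_eq_double tails_match_double)
qed

section \<open>Continuity in both directions\<close>

lemma openin_double_vimage:
  assumes "openin (path_topology X) U"
  shows "openin (path_topology G) {z \<in> path_groupoid_elements G. double_triple z \<in> U}"
    (is "openin _ ?V")
proof -
  have U: "nbhd_open X U"
    using assms openin_path_topology_iff X.wf_digraph_axioms by blast
  have "nbhd_open G ?V"
    unfolding nbhd_open_def
  proof clarify
    fix u k w assume z: "(u, k, w) \<in> path_groupoid_elements G" "double_triple (u, k, w) \<in> U"
    then have uw: "u \<in> inf_paths G" "w \<in> inf_paths G" and "(double u, 2 * k, double w) \<in> U"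
      by (auto simp: path_groupoid_elements_def double_triple_def)
    then obtain m n where mn: "0 < m" "0 < n" "2 * k = int m - int n"
      "tails_match (double u) m (double w) n" "pair_nbhd X (double u) m (double w) n \<subseteq> U"
      using nbhd_openE[OF U] by metis
    obtain n' where n': "n + m = 2 * n'" "2 * k = 2 * (int m - int n')" "tails_match u m w n'"
      by (rule tails_match_evenE[OF mn(4) uw mn(3)])
    have "0 < n'"
      using n'(1) mn by linarith
    \<comment> \<open>The neighbourhood obtained in \<open>X\<close> may have odd lengths.
      Prolonging both by \<open>m\<close> gives the even lengths \<open>2 * m\<close> and
      \<open>2 * n'\<close> and only shrinks it.\<close>
    have "pair_nbhd X (double u) (2 * m) (double w) (2 * n') \<subseteq> U"
      using pair_nbhd_add[OF mn(4), of X m] mn(5) unfolding n'(1) by (simp add: mult_2)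
    then have "pair_nbhd G u m w n' \<subseteq> ?V"
      using double_triple_in_pair_nbhd_iff[OF uw] pair_nbhd_subset_elements[OF \<open>0 < m\<close> \<open>0 < n'\<close>, of G]
      by blast
    then show "\<exists>m n. 0 < m \<and> 0 < n \<and> k = int m - int n \<and> tails_match u m w n \<and>
        pair_nbhd G u m w n \<subseteq> ?V"
      using n' mn(1) \<open>0 < n'\<close> by (intro exI[of _ m] exI[of _ n']) simp
  qed
  then show ?thesis
    by (simp add: openin_path_topology_iff[OF G.wf_digraph_axioms])
qed

lemma openin_halve_vimage:
  assumes "openin (path_topology G) U"
  shows "openin (path_topology X) {g \<in> pointed_elements. halve_triple g \<in> U}"
    (is "openin _ ?V")
proof -
  have U: "nbhd_open G U"
    using assms openin_path_topology_iff G.wf_digraph_axioms by blast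
  have "nbhd_open X ?V"
    unfolding nbhd_open_def
  proof clarify
    fix x k y assume g: "(x, k, y) \<in> pointed_elements" "halve_triple (x, k, y) \<in> U"
    then have "(halve x, k div 2, halve y) \<in> U" and xy: "x \<in> pointed_paths" "y \<in> pointed_paths"
      by (auto simp: halve_triple_def pointed_elements_iff)
    then obtain m n where mn: "0 < m" "0 < n" "k div 2 = int m - int n"
      "tails_match (halve x) m (halve y) n" "pair_nbhd G (halve x) m (halve y) n \<subseteq> U"
      using nbhd_openE[OF U] by metis
    note h = halve_in_inf_paths[OF xy(1)] halve_in_inf_paths[OF xy(2)]
    have "pair_nbhd X x (2 * m) y (2 * n) \<subseteq> ?V"
    proof
      fix g' assume g': "g' \<in> pair_nbhd X x (2 * m) y (2 * n)"
      then have el: "g' \<in> path_groupoid_elements X"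
        using pair_nbhd_subset_elements[of "2 * m" "2 * n" X x y] mn by auto
      obtain x' k' y' where xyz: "g' = (x', k', y')"
        by (cases g')
      \<comment> \<open>Positive lengths prescribe the first arcs and with them the sources, so
        \<open>g'\<close> cannot leave \<open>pointed_elements\<close>.\<close>
      have "x' !! 0 = x !! 0" "y' !! 0 = y !! 0"
        using g' mn(1,2) unfolding xyz pair_nbhd_def by (simp_all)
      then have P: "g' \<in> pointed_elements"
        using el xy
        by (simp add: pointed_elements_def pointed_paths_def xyz inf_source_snth)
      have "halve_triple g' \<in> pair_nbhd G (halve x) m (halve y) n"
        using double_triple_in_pair_nbhd_iff[OF h halve_triple_in[OF P], of m n] g'
        by (simp add: double_halve_triple[OF P] double_halve xy)
      then show "g' \<in> ?V"
        using P mn(5) by blast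
    qed
    moreover have "tails_match x (2 * m) y (2 * n)"
      using tails_match_double[OF h] mn(4) by (simp add: double_halve xy)
    moreover have "k = int (2 * m) - int (2 * n)"
      using mn(3) pointed_elements_even[OF g(1)] by auto
    ultimately show "\<exists>m n. 0 < m \<and> 0 < n \<and> k = int m - int n \<and> tails_match x m y n \<and>
        pair_nbhd X x m y n \<subseteq> ?V"
      using mn(1,2) by (intro exI[of _ "2 * m"] exI[of _ "2 * n"]) simp
  qed
  moreover have "?V \<subseteq> path_groupoid_elements X"
    by (auto simp: pointed_elements_def)
  ultimately show ?thesis
    by (simp add: openin_path_topology_iff[OF X.wf_digraph_axioms])
qed

lemma homeomorphic_maps_halve_double:
  "homeomorphic_maps (subtopology (path_topology X) pointed_elements) (path_topology G)
     halve_triple double_triple"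
proof -
  let ?T = "subtopology (path_topology X) pointed_elements"
  have G: "topspace (path_topology G) = path_groupoid_elements G"
    by (rule topspace_path_topology) (rule G.wf_digraph_axioms)
  have X: "topspace ?T = pointed_elements"
    by (auto simp: topspace_path_topology[OF X.wf_digraph_axioms] pointed_elements_def)
  \<comment> \<open>As the preimage of the whole space, \<open>pointed_elements\<close> is open in
    the groupoid of \<open>X\<close>. Hence the open sets of the subspace are just the open sets of
    \<open>X\<close> contained in it.\<close>
  have "{g \<in> pointed_elements. halve_triple g \<in> path_groupoid_elements G} = pointed_elements"
    using halve_triple_in by blast
  then have op: "openin (path_topology X) pointed_elements"
    using openin_halve_vimage[OF openin_topspace] unfolding G by simp
  have "continuous_map ?T (path_topology G) halve_triple"
    unfolding continuous_map X G
    using halve_triple_in openin_halve_vimage by (auto simp: openin_open_subtopology[OF op])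
  moreover have "continuous_map (path_topology G) ?T double_triple"
    unfolding continuous_map X G
    using double_triple_in openin_double_vimage by (auto simp: openin_open_subtopology[OF op])
  ultimately show ?thesis
    unfolding homeomorphic_maps_def X G using halve_double_triple double_halve_triple by blast
qed

theorem pointed_groupoid_isomorphic:
  "groupoid_isomorphic (pointed_groupoid X (\<iota> ` verts G)) (path_groupoid G)"
proof -
  let ?C = "{(x, k, y). inf_source X x \<in> \<iota> ` verts G \<and> inf_source X y \<in> \<iota> ` verts G}"
  let ?P = "pointed_groupoid X (\<iota> ` verts G)"
  have el: "elements ?P = pointed_elements"
    by (simp add: pointed_groupoid_def restrict_groupoid_def path_groupoid_def pointed_elements_def)
  \<comment> \<open>A subspace topology depends only on the part of the set inside the whole space,
    so \<open>?C\<close> can be cut down to \<open>pointed_elements\<close>.\<close>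
  have top: "gtopology ?P = subtopology (path_topology X) pointed_elements"
    using subtopology_restrict[of "path_topology X" ?C]
    by (simp add: pointed_groupoid_def restrict_groupoid_def path_groupoid_def pointed_elements_def
        topspace_path_topology[OF X.wf_digraph_axioms])
  have ops: "composable ?P = (\<lambda>(x, k, y) (y', l, z). y = y')"
    "compose ?P = (\<lambda>(x, k, y) (y', l, z). (x, k + l, z))" "invert ?P = (\<lambda>(x, k, y). (y, - k, x))"
    by (simp_all add: pointed_groupoid_def restrict_groupoid_def path_groupoid_def)
  have "bij_betw halve_triple pointed_elements (path_groupoid_elements G)"
    by (rule bij_betw_byWitness[where f' = double_triple])
      (auto simp: double_halve_triple halve_double_triple halve_triple_in double_triple_in)
  moreover have "homeomorphic_map (gtopology ?P) (path_topology G) halve_triple"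
    unfolding top homeomorphic_map_maps using homeomorphic_maps_halve_double by blast
  \<comment> \<open>Evenness of \<open>k\<close> is essential: rounding down does not commute with
    negation on odd numbers, and it is additive once one summand is even.\<close>
  moreover have "halve_triple (y, - k, x) = (\<lambda>(x, k, y). (y, - k, x)) (halve_triple (x, k, y))"
    if "(x, k, y) \<in> pointed_elements" for x k y
    using pointed_elements_even[OF that] by (auto simp: halve_triple_def)
  moreover have "halve_triple (x, k + l, z) =
      (\<lambda>(x, k, y) (y', l, z). (x, k + l, z)) (halve_triple (x, k, y)) (halve_triple (y, l, z))"
    if "(x, k, y) \<in> pointed_elements" "(y, l, z) \<in> pointed_elements" for x k y l z
    using pointed_elements_even[OF that(1)] by (auto simp: halve_triple_def)
  \<comment> \<open>Injectivity of \<open>halve\<close> on \<open>pointed_paths\<close> ensures that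
    no new pairs become composable.\<close>
  moreover have "halve y = halve y' \<longleftrightarrow> y = y'"
    if "(x, k, y) \<in> pointed_elements" "(y', l, z) \<in> pointed_elements" for x k y y' l z
    using that double_halve unfolding pointed_elements_iff by metis
  ultimately have "groupoid_isomorphism ?P (path_groupoid G) halve_triple"
    unfolding groupoid_isomorphism_def el ops
    by (simp add: path_groupoid_def split: prod.splits) (auto simp: halve_triple_def)
  then show ?thesis
    unfolding groupoid_isomorphic_def by blast
qed

end


section \<open>Pairings from matrix products\<close>

text \<open>In a discrete space convergence means being eventually constant. Beyond some finite set
  \<open>B\<close>, adding one more index leaves the sum unchanged, so \<open>f\<close> vanishes
  outside \<open>B\<close>.\<close>

lemma has_sum_nat_finite_support:
  fixes f :: "'a \<Rightarrow> nat"
  assumes "(f has_sum s) A"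
  shows "finite {a \<in> A. f a \<noteq> 0}" and "s = sum f {a \<in> A. f a \<noteq> 0}"
proof -
  have "\<forall>\<^sub>F B in finite_subsets_at_top A. sum f B = s"
    using assms unfolding has_sum_def by (simp add: tendsto_discrete)
  then obtain B where B: "finite B" "B \<subseteq> A" "\<And>C. finite C \<Longrightarrow> B \<subseteq> C \<Longrightarrow> C \<subseteq> A \<Longrightarrow> sum f C = s"
    unfolding eventually_finite_subsets_at_top by blast
  have "a \<in> B" if "a \<in> A" "f a \<noteq> 0" for a
    using B(3)[of "insert a B"] B(3)[of B] B(1,2) that by (cases "a \<in> B") auto
  then have sub: "{a \<in> A. f a \<noteq> 0} \<subseteq> B"
    by auto
  then show "finite {a \<in> A. f a \<noteq> 0}"
    using B(1) by (rule finite_subset)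
  have "sum f {a \<in> A. f a \<noteq> 0} = sum f B"
    by (rule sum.mono_neutral_left) (use B sub in auto)
  then show "s = sum f {a \<in> A. f a \<noteq> 0}"
    using B by simp
qed

text \<open>An entry of the product \<open>R S\<close> counts the paths of length two in
  \<open>X\<close> between two vertices in the image of \<iota>, while the same entry of the vertex
  matrix counts arcs of \<open>G\<close>. Equally large finite sets are in bijection, and these
  bijections are glued over all pairs of vertices. General injections \<iota> and \<kappa> let one
  statement serve both sides.\<close>

lemma arc_pairing_exists:
  fixes G :: "('v, 'e) pre_digraph" and X :: "('u, 'x) pre_digraph"
    and \<iota> :: "'v \<Rightarrow> 'u" and \<kappa> :: "'w \<Rightarrow> 'u"
  assumes G: "wf_digraph G" "\<And>v w. finite (arcs_from_to G v w)" and X: "wf_digraph X"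
    and verts: "verts X = \<iota> ` verts G \<union> \<kappa> ` W" "\<iota> ` verts G \<inter> \<kappa> ` W = {}"
    and inj: "inj_on \<iota> (verts G)" "inj_on \<kappa> W"
    and fin: "\<And>p q. p \<in> verts X \<Longrightarrow> q \<in> verts X \<Longrightarrow> finite (arcs_from_to X p q)"
    and R: "\<And>v w. v \<in> verts G \<Longrightarrow> w \<in> W \<Longrightarrow> vertex_matrix X (\<iota> v) (\<kappa> w) = R v w"
    and S: "\<And>v w. v \<in> verts G \<Longrightarrow> w \<in> W \<Longrightarrow> vertex_matrix X (\<kappa> w) (\<iota> v) = S w v"
    and zero: "\<And>v v'. v \<in> verts G \<Longrightarrow> v' \<in> verts G \<Longrightarrow> vertex_matrix X (\<iota> v) (\<iota> v') = 0"
      "\<And>w w'. w \<in> W \<Longrightarrow> w' \<in> W \<Longrightarrow> vertex_matrix X (\<kappa> w) (\<kappa> w') = 0"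
    and prod: "is_matrix_product (verts G) W (verts G) (vertex_matrix G) R S"
  shows "\<exists>pr. arc_pairing G X \<iota> pr"
proof -
  interpret G: wf_digraph G by fact
  interpret X: wf_digraph X by fact
  let ?Q = "{(a, b). a \<in> arcs X \<and> b \<in> arcs X \<and> head X a = tail X b \<and> tail X a \<in> \<iota> ` verts G}"
  let ?P = "\<lambda>v v'. {(a, b) \<in> ?Q. tail X a = \<iota> v \<and> head X b = \<iota> v'}"
  \<comment> \<open>An infinite set also has \<open>card\<close> zero, so it takes
    \<open>fin\<close> to conclude that a zero entry excludes arcs.\<close>
  have no_arc: "\<not> (tail X a = p \<and> head X a = q)"
    if "a \<in> arcs X" "p \<in> verts X" "q \<in> verts X" "vertex_matrix X p q = 0" for a p q
    using that fin[of p q] by (auto simp: vertex_matrix_def arcs_from_to_def)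
  have alt: "head X a \<in> \<iota> ` verts G \<longleftrightarrow> tail X a \<notin> \<iota> ` verts G" if a: "a \<in> arcs X" for a
  proof -
    have False if "tail X a = \<iota> v" "head X a = \<iota> v'" "v \<in> verts G" "v' \<in> verts G" for v v'
      using no_arc[OF a _ _ zero(1)[OF that(3,4)]] that verts(1) by simp
    then have "\<not> (tail X a \<in> \<iota> ` verts G \<and> head X a \<in> \<iota> ` verts G)"
      by blast
    moreover have False if "tail X a = \<kappa> w" "head X a = \<kappa> w'" "w \<in> W" "w' \<in> W" for w w'
      using no_arc[OF a _ _ zero(2)[OF that(3,4)]] that verts(1) by simp
    then have "\<not> (tail X a \<in> \<kappa> ` W \<and> head X a \<in> \<kappa> ` W)"
      by blast
    ultimately show ?thesis
      using X.tail_in_verts[OF a] X.head_in_verts[OF a] verts by blast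
  qed
  have ex_bij: "\<exists>f. bij_betw f (arcs_from_to G v v') (?P v v')" if v: "v \<in> verts G" "v' \<in> verts G" for v v'
  proof -
    let ?T = "\<lambda>w. arcs_from_to X (\<iota> v) (\<kappa> w) \<times> arcs_from_to X (\<kappa> w) (\<iota> v')"
    let ?K = "{w \<in> W. R v w * S w v' \<noteq> 0}"
    have hs: "((\<lambda>w. R v w * S w v') has_sum vertex_matrix G v v') W"
      using prod v unfolding is_matrix_product_def by blast
    have T: "finite (?T w)" "card (?T w) = R v w * S w v'" if "w \<in> W" for w
      using R[OF v(1) that] S[OF v(2) that] fin verts(1) v that
      by (auto simp: vertex_matrix_def card_cartesian_product)
    have "?P v v' = (\<Union>w\<in>W. ?T w)"
    proof (intro equalityI subsetI)
      fix c assume "c \<in> ?P v v'"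
      then obtain a b where c: "c = (a, b)" and ab: "a \<in> arcs X" "b \<in> arcs X"
        "head X a = tail X b" "tail X a = \<iota> v" "head X b = \<iota> v'"
        by blast
      have "head X a \<notin> \<iota> ` verts G"
        using alt[OF ab(1)] ab(4) v(1) by simp
      then obtain w where "w \<in> W" "head X a = \<kappa> w"
        using X.head_in_verts[OF ab(1)] verts(1) by blast
      then show "c \<in> (\<Union>w\<in>W. ?T w)"
        using ab c by (auto simp: arcs_from_to_def)
    qed (use v in \<open>auto simp: arcs_from_to_def\<close>)
    \<comment> \<open>The set \<open>W\<close> of middle vertices may be infinite. Only those with a
      nonzero summand contribute paths, and there are finitely many of them, so cardinalities can be
      added.\<close>
    also have "\<dots> = (\<Union>w\<in>?K. ?T w)"
    proof (intro equalityI subsetI)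
      fix c assume "c \<in> (\<Union>w\<in>W. ?T w)"
      then obtain w where w: "w \<in> W" "c \<in> ?T w"
        by (rule UN_E)
      then have "card (?T w) \<noteq> 0"
        using T(1)[OF w(1)] card_0_eq by (metis empty_iff)
      then have "w \<in> ?K"
        using T(2)[OF w(1)] w(1) by simp
      then show "c \<in> (\<Union>w\<in>?K. ?T w)"
        using w(2) by (rule UN_I)
    qed auto
    finally have P: "?P v v' = (\<Union>w\<in>?K. ?T w)" .
    have K: "finite ?K"
      by (rule has_sum_nat_finite_support[OF hs])
    have "card (?P v v') = (\<Sum>w\<in>?K. card (?T w))"
      unfolding P
    proof (rule card_UN_disjoint[OF K])
      show "\<forall>w\<in>?K. \<forall>w'\<in>?K. w \<noteq> w' \<longrightarrow> ?T w \<inter> ?T w' = {}"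
        using inj(2) by (auto simp: arcs_from_to_def inj_on_def)
    qed (use T in blast)
    also have "\<dots> = (\<Sum>w\<in>?K. R v w * S w v')"
      by (rule sum.cong) (use T in auto)
    also have "\<dots> = vertex_matrix G v v'"
      by (rule has_sum_nat_finite_support(2)[OF hs, symmetric])
    finally have "card (arcs_from_to G v v') = card (?P v v')"
      by (simp add: vertex_matrix_def)
    \<comment> \<open>Equal values of \<open>card\<close> give a bijection only between finite
      sets.\<close>
    moreover have "finite (?P v v')"
      unfolding P using K T by blast
    ultimately show ?thesis
      using finite_same_card_bij G(2) by blast
  qed
  define f where "f = (\<lambda>v v'. SOME f. bij_betw f (arcs_from_to G v v') (?P v v'))"
  have f: "bij_betw (f v v') (arcs_from_to G v v') (?P v v')" if "v \<in> verts G" "v' \<in> verts G" for v v'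
    using someI_ex[OF ex_bij[OF that]] unfolding f_def .
  define pr where "pr = (\<lambda>e. f (tail G e) (head G e) e)"
  have pr: "pr e \<in> ?P (tail G e) (head G e)" if "e \<in> arcs G" for e
    unfolding pr_def
    by (rule bij_betwE[OF f[OF G.tail_in_verts[OF that] G.head_in_verts[OF that]], rule_format])
      (simp add: arcs_from_to_def that)
  have ends: "tail X (fst (pr e)) = \<iota> (tail G e)" "head X (snd (pr e)) = \<iota> (head G e)"
    if "e \<in> arcs G" for e
    using pr[OF that] by (auto simp: case_prod_beta)
  have "inj_on pr (arcs G)"
  proof (rule inj_onI)
    fix e e' assume e: "e \<in> arcs G" "e' \<in> arcs G" "pr e = pr e'"
    \<comment> \<open>The image path remembers its end vertices, so arcs with the same image are
      handled by the same bijection \<open>f v v'\<close>.\<close>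
    have "\<iota> (tail G e) = \<iota> (tail G e')" "\<iota> (head G e) = \<iota> (head G e')"
      using ends[OF e(1)] ends[OF e(2)] e(3) by simp_all
    then have eq: "tail G e = tail G e'" "head G e = head G e'"
      using inj_on_eq_iff[OF inj(1)] G.tail_in_verts G.head_in_verts e(1,2) by blast+
    have "inj_on (f (tail G e) (head G e)) (arcs_from_to G (tail G e) (head G e))"
      using f[OF G.tail_in_verts[OF e(1)] G.head_in_verts[OF e(1)]] by (rule bij_betw_imp_inj_on)
    then show "e = e'"
      by (rule inj_onD) (use e eq in \<open>simp_all add: pr_def arcs_from_to_def\<close>)
  qed
  moreover have "pr ` arcs G = ?Q"
  proof (intro equalityI subsetI)
    fix c assume c: "c \<in> ?Q"
    then obtain a b where ab: "c = (a, b)" "a \<in> arcs X" "b \<in> arcs X"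
      "head X a = tail X b" "tail X a \<in> \<iota> ` verts G"
      by blast
    then have "head X b \<in> \<iota> ` verts G"
      using alt by metis
    then obtain v v' where v: "v \<in> verts G" "v' \<in> verts G" "tail X a = \<iota> v" "head X b = \<iota> v'"
      using ab(5) by blast
    then have "c \<in> ?P v v'"
      using c ab(1) by simp
    then obtain e where "e \<in> arcs_from_to G v v'" "c = f v v' e"
      using bij_betw_imp_surj_on[OF f[OF v(1,2)]] by blast
    then show "c \<in> pr ` arcs G"
      by (auto simp: pr_def arcs_from_to_def)
  next
    fix c assume "c \<in> pr ` arcs G"
    then obtain e where "e \<in> arcs G" "c = pr e"
      by blast
    then show "c \<in> ?Q"
      using pr[of e] by auto
  qed
  ultimately have "bij_betw pr (arcs G) ?Q"
    by (simp add: bij_betw_def)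
  then have "arc_pairing G X \<iota> pr"
    using inj(1) ends alt by unfold_locales auto
  then show ?thesis
    by (rule exI[of _ pr])
qed

section \<open>Application to both sides of the imprimitivity graph\<close>

lemma graph_convention_wf: "graph_convention G \<Longrightarrow> wf_digraph G"
  unfolding graph_convention_def nomulti_digraph_def by blast

lemma finite_arcs_from_to:
  assumes "wf_digraph G" "row_finite G"
  shows "finite (arcs_from_to G v w)"
proof (cases "v \<in> verts G")
  case True
  then have "finite (out_arcs G v)"
    using assms(2) by (simp add: row_finite_def)
  then show ?thesis
    by (rule rev_finite_subset) (auto simp: arcs_from_to_def out_arcs_def)
next
  case False
  then have "arcs_from_to G v w = {}"
    using wf_digraph.tail_in_verts[OF assms(1)] by (auto simp: arcs_from_to_def)
  then show ?thesis by simp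
qed

theorem proposition7p2:
  fixes E :: "('v, 'e) pre_digraph"
    and F :: "('w, 'f) pre_digraph"
    and R :: "'v \<Rightarrow> 'w \<Rightarrow> nat"
    and S :: "'w \<Rightarrow> 'v \<Rightarrow> nat"
    and X :: "('v + 'w, 'x) pre_digraph"
  assumes "graph_convention E" and "row_finite E"
    and "graph_convention F" and "row_finite F"
    and "elementary_sse_via E F R S"
    and "imprimitivity_graph E F R S X"
  shows "groupoid_isomorphic (pointed_groupoid X (Inl ` verts E)) (path_groupoid E) \<and>
         groupoid_isomorphic (pointed_groupoid X (Inr ` verts F)) (path_groupoid F)"
proof -
  have wf: "wf_digraph E" "wf_digraph F"
    using assms(1,3) graph_convention_wf by blast+
  have X: "wf_digraph X" "verts X = Inl ` verts E \<union> Inr ` verts F"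
    and B: "\<And>p q. p \<in> verts X \<Longrightarrow> q \<in> verts X \<Longrightarrow>
      finite (arcs_from_to X p q) \<and> vertex_matrix X p q = imprimitivity_matrix R S p q"
    using assms(6) unfolding imprimitivity_graph_def Plus_def by blast+
  have "\<exists>pr. arc_pairing E X Inl pr"
    by (rule arc_pairing_exists[where \<kappa> = Inr and W = "verts F" and R = R and S = S])
      (use wf X B finite_arcs_from_to[OF wf(1) assms(2)] assms(5) in
        \<open>auto simp: elementary_sse_via_def inj_on_def\<close>)
  \<comment> \<open>The hypotheses are symmetric: exchanging the two graphs also exchanges
    \<open>R\<close> with \<open>S\<close> and \<open>Inl\<close> with \<open>Inr\<close>.\<close>
  moreover have "\<exists>pr. arc_pairing F X Inr pr"
    by (rule arc_pairing_exists[where \<kappa> = Inl and W = "verts E" and R = S and S = R])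
      (use wf X B finite_arcs_from_to[OF wf(2) assms(4)] assms(5) in
        \<open>auto simp: elementary_sse_via_def inj_on_def\<close>)
  ultimately show ?thesis
    by (auto intro: arc_pairing.pointed_groupoid_isomorphic)
qed

end
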